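(* Let $G_{48}$ be the graph on vertex set $\{0,1,\dots,47\}$ with the following $50$ edges: $(0,1)$, $(0,2)$, $(0,3)$, $(1,5)$, $(1,12)$, $(1,13)$, $(2,12)$, $(3,16)$, $(3,24)$, $(4,5)$, $(4,6)$, $(5,7)$, $(5,8)$, $(6,31)$, $(7,25)$, $(9,10)$, $(9,11)$, $(11,14)$, $(11,15)$, $(13,22)$, $(13,28)$, $(14,26)$, $(15,27)$, $(16,17)$, $(17,29)$, $(17,30)$, $(18,19)$, $(19,20)$, $(20,31)$, $(21,22)$, $(21,23)$, $(24,43)$, $(25,26)$, $(26,27)$, $(28,32)$, $(29,37)$, $(30,38)$, $(30,39)$, $(32,46)$, $(33,34)$, $(33,35)$, $(34,36)$, $(36,43)$, $(37,39)$, $(38,40)$, $(38,41)$, $(40,42)$, $(41,44)$, $(44,45)$, $(46,47)$. Then $G_{48}$ is connected and triangle-free, with maximum degree $4$, cycle rank $3$, and minimum cycle basis of lengths $(4,5,5)$. Its line graph $L(G_{48})$ has $50$ vertices and inertia $\mathrm{In}(L(G_{48})) = (26,0,24)$, hence $s(L(G_{48})) = 2$.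
   Context: All graphs are finite and simple. For a graph $H$ with adjacency matrix $A(H)$, $n^{+}(H)$, $n^{0}(H)$, $n^{-}(H)$ denote the numbers of positive, zero and negative eigenvalues of $A(H)$, counted with multiplicity; the inertia is $\mathrm{In}(H) = (n^{+}(H), n^{0}(H), n^{-}(H))$ and the signature is $s(H) = n^{+}(H) - n^{-}(H)$. The line graph $L(G)$ has the edges of $G$ as vertices, two being adjacent when they are distinct and share an endpoint. The cycle rank of a connected graph with $n$ vertices and $m$ edges is $m-n+1$, the dimension over $\mathbb{F}_2$ of its cycle space; a minimum cycle basis is a basis of the cycle space consisting of cycles with minimum total length. *)

theory Defs
  imports
    "HOL-Library.Function_Algebras"
    "HOL-Library.Multiset"
    "HOL-Library.Z2"
    "Jordan_Normal_Form.Char_Poly"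
begin

section \<open>Finite simple graphs\<close>

record 'a ugraph =
  verts :: "'a set"
  edges :: "'a set set"

definition simple_graph :: "'a ugraph \<Rightarrow> bool" where
  "simple_graph G \<longleftrightarrow> finite (verts G) \<and> (\<forall>e\<in>edges G. e \<subseteq> verts G \<and> card e = 2)"

definition adjacency :: "'a ugraph \<Rightarrow> ('a \<times> 'a) set" where
  "adjacency G = {(u, v). {u, v} \<in> edges G}"

definition connected_graph :: "'a ugraph \<Rightarrow> bool" where
  "connected_graph G \<longleftrightarrow> verts G \<noteq> {} \<and> (\<forall>u\<in>verts G. \<forall>v\<in>verts G. (u, v) \<in> (adjacency G)\<^sup>*)"

definition triangle_free :: "'a ugraph \<Rightarrow> bool" where
  "triangle_free G \<longleftrightarrow> \<not> (\<exists>u v w. {u, v} \<in> edges G \<and> {v, w} \<in> edges G \<and> {u, w} \<in> edges G)"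

definition vertex_degree :: "'a ugraph \<Rightarrow> 'a \<Rightarrow> nat" where
  "vertex_degree G v = card {e \<in> edges G. v \<in> e}"

definition max_degree :: "'a ugraph \<Rightarrow> nat" where
  "max_degree G = Max (vertex_degree G ` verts G)"

definition line_graph :: "'a ugraph \<Rightarrow> 'a set ugraph" where
  "line_graph G = \<lparr>verts = edges G,
     edges = {{e, f} | e f. e \<in> edges G \<and> f \<in> edges G \<and> e \<noteq> f \<and> e \<inter> f \<noteq> {}}\<rparr>"

lemma simple_graph_line_graph:
  assumes "simple_graph G"
  shows "simple_graph (line_graph G)"
proof -
  have "edges G \<subseteq> Pow (verts G)" "finite (Pow (verts G))"
    using assms by (auto simp: simple_graph_def)
  then have "finite (edges G)" by (rule finite_subset)
  then show ?thesis by (auto simp: simple_graph_def line_graph_def card_2_iff)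
qed


section \<open>The cycle space over the two-element field\<close>

text \<open>
  A vector of the edge space is a function from edges to \<^typ>\<open>bit\<close>. The cycle space consists of
  the vectors that are supported on the edge set and have even degree at every vertex.
\<close>

definition edge_scale :: "bit \<Rightarrow> ('e \<Rightarrow> bit) \<Rightarrow> 'e \<Rightarrow> bit" where
  "edge_scale c x = (\<lambda>e. c * x e)"

interpretation edge_space: vector_space "edge_scale :: bit \<Rightarrow> ('e \<Rightarrow> bit) \<Rightarrow> 'e \<Rightarrow> bit"
  by unfold_locales (simp_all only: edge_scale_def fun_eq_iff plus_fun_def distrib_left
      distrib_right mult.assoc mult_1, simp_all)

definition cycle_space :: "'a ugraph \<Rightarrow> ('a set \<Rightarrow> bit) set" where
  "cycle_space G = {x. (\<forall>e. e \<notin> edges G \<longrightarrow> x e = 0) \<and>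
     (\<forall>v\<in>verts G. (\<Sum>e | e \<in> edges G \<and> v \<in> e. x e) = 0)}"

definition edge_vector :: "'e set \<Rightarrow> 'e \<Rightarrow> bit" where
  "edge_vector C = (\<lambda>e. of_bool (e \<in> C))"

definition cycle_rank :: "'a ugraph \<Rightarrow> int" where
  "cycle_rank G = int (card (edges G)) - int (card (verts G)) + 1"

text \<open>
  A cycle is identified with its edge set, so that its length is the cardinality of that set.
\<close>

definition closed_walk_edges :: "'a list \<Rightarrow> 'a set set" where
  "closed_walk_edges vs = {{vs ! i, vs ! (Suc i mod length vs)} | i. i < length vs}"

definition is_cycle :: "'a ugraph \<Rightarrow> 'a set set \<Rightarrow> bool" where
  "is_cycle G C \<longleftrightarrow> C \<subseteq> edges G \<and>
     (\<exists>vs. length vs \<ge> 3 \<and> distinct vs \<and> C = closed_walk_edges vs)"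

definition cycle_basis :: "'a ugraph \<Rightarrow> 'a set set set \<Rightarrow> bool" where
  "cycle_basis G B \<longleftrightarrow> (\<forall>C\<in>B. is_cycle G C) \<and>
     edge_space.independent (edge_vector ` B) \<and>
     edge_space.span (edge_vector ` B) = cycle_space G"

definition minimum_cycle_basis :: "'a ugraph \<Rightarrow> 'a set set set \<Rightarrow> bool" where
  "minimum_cycle_basis G B \<longleftrightarrow> cycle_basis G B \<and>
     (\<forall>B'. cycle_basis G B' \<longrightarrow> (\<Sum>C\<in>B. card C) \<le> (\<Sum>C\<in>B'. card C))"

definition cycle_lengths :: "'a set set set \<Rightarrow> nat multiset" where
  "cycle_lengths B = image_mset card (mset_set B)"


section \<open>Inertia\<close>

definition adjacency_matrix_wrt :: "'a list \<Rightarrow> 'a ugraph \<Rightarrow> real mat" where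
  "adjacency_matrix_wrt vs G =
     mat (length vs) (length vs) (\<lambda>(i, j). of_bool ({vs ! i, vs ! j} \<in> edges G))"

text \<open>
  The vertices are enumerated in an arbitrary order; by the lemma below, the choice does not
  affect the characteristic polynomial, and hence does not affect the inertia.
\<close>

definition adjacency_matrix :: "'a ugraph \<Rightarrow> real mat" where
  "adjacency_matrix G =
     adjacency_matrix_wrt (SOME vs. distinct vs \<and> set vs = verts G) G"

lemma char_poly_adjacency_matrix:
  assumes "distinct vs" "set vs = verts G"
  shows "char_poly (adjacency_matrix G) = char_poly (adjacency_matrix_wrt vs G)"
proof -
  define ws where "ws = (SOME vs. distinct vs \<and> set vs = verts G)"
  have ws: "distinct ws" "set ws = verts G"
    using someI[of "\<lambda>vs. distinct vs \<and> set vs = verts G" vs] assms by (auto simp: ws_def)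
  define n where "n = length vs"
  have n: "length ws = n"
    using ws assms by (metis n_def distinct_card)
  have "\<forall>i<n. \<exists>k<n. vs ! k = ws ! i"
    by (metis assms(2) in_set_conv_nth n n_def ws(2))
  then obtain p where p: "\<And>i. i < n \<Longrightarrow> p i < n \<and> vs ! p i = ws ! i"
    by metis
  have p_inj: "p i = p j \<longleftrightarrow> i = j" if "i < n" "j < n" for i j
    using that p[of i] p[of j] ws(1) n by (metis nth_eq_iff_index_eq)
  let ?A = "adjacency_matrix_wrt vs G" and ?B = "adjacency_matrix_wrt ws G"
  define P :: "real mat" where "P = mat n n (\<lambda>(i, k). of_bool (k = p i))"
  define Q :: "real mat" where "Q = mat n n (\<lambda>(k, j). of_bool (k = p j))"
  have car: "P \<in> carrier_mat n n" "Q \<in> carrier_mat n n" "?A \<in> carrier_mat n n" "?B \<in> carrier_mat n n"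
    using n n_def by (auto simp: P_def Q_def adjacency_matrix_wrt_def)
  have PQ: "P * Q = 1\<^sub>m n"
    by (rule eq_matI)
      (use p p_inj in \<open>auto simp: P_def Q_def scalar_prod_def if_distrib cong: if_cong\<close>)
  have QP: "Q * P = 1\<^sub>m n"
    by (rule mat_mult_left_right_inverse[OF car(1,2) PQ])
  have PA: "P * ?A = mat n n (\<lambda>(i, j). ?A $$ (p i, j))"
    by (rule eq_matI)
      (use p in \<open>auto simp: P_def adjacency_matrix_wrt_def scalar_prod_def n_def[symmetric]\<close>)
  have "?B = P * ?A * Q"
    unfolding PA
    by (rule eq_matI)
      (use p n in \<open>auto simp: Q_def adjacency_matrix_wrt_def scalar_prod_def n_def[symmetric]\<close>)
  then have "similar_mat ?B ?A"
    using car PQ QP by (intro similar_matI[of _ _ P Q n]) auto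
  then show ?thesis
    using char_poly_similar unfolding adjacency_matrix_def ws_def by blast
qed

text \<open>
  The real matrix at hand is symmetric, so all its eigenvalues are real, and the algebraic
  multiplicity used here agrees with the geometric one.
\<close>

definition eigenvalue_count :: "real mat \<Rightarrow> (real \<Rightarrow> bool) \<Rightarrow> nat" where
  "eigenvalue_count A P = (\<Sum>x | eigenvalue A x \<and> P x. order x (char_poly A))"

definition n_pos :: "'a ugraph \<Rightarrow> nat" where
  "n_pos G = eigenvalue_count (adjacency_matrix G) (\<lambda>x. x > 0)"

definition n_zero :: "'a ugraph \<Rightarrow> nat" where
  "n_zero G = eigenvalue_count (adjacency_matrix G) (\<lambda>x. x = 0)"

definition n_neg :: "'a ugraph \<Rightarrow> nat" where
  "n_neg G = eigenvalue_count (adjacency_matrix G) (\<lambda>x. x < 0)"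

definition inertia :: "'a ugraph \<Rightarrow> nat \<times> nat \<times> nat" where
  "inertia G = (n_pos G, n_zero G, n_neg G)"

definition signature :: "'a ugraph \<Rightarrow> int" where
  "signature G = int (n_pos G) - int (n_neg G)"


section \<open>The graph on 48 vertices\<close>

definition G48 :: "nat ugraph" where
  "G48 = \<lparr>verts = {0..47}, edges = (\<lambda>(u, v). {u, v}) ` set
    [(0,1), (0,2), (0,3), (1,5), (1,12), (1,13), (2,12), (3,16), (3,24),
     (4,5), (4,6), (5,7), (5,8), (6,31), (7,25), (9,10), (9,11),
     (11,14), (11,15), (13,22), (13,28), (14,26), (15,27), (16,17),
     (17,29), (17,30), (18,19), (19,20), (20,31), (21,22), (21,23),
     (24,43), (25,26), (26,27), (28,32), (29,37), (30,38), (30,39),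
     (32,46), (33,34), (33,35), (34,36), (36,43), (37,39), (38,40),
     (38,41), (40,42), (41,44), (44,45), (46,47)]\<rparr>"

lemma simple_graph_G48: "simple_graph G48"
  by (simp add: simple_graph_def G48_def)

lemma card_edges_G48: "card (edges G48) = 50"
  by (simp add: G48_def doubleton_eq_iff)

end

theory Submission
  imports Defs "Jordan_Normal_Form.Spectral_Radius" "Jordan_Normal_Form.Schur_Decomposition"
begin

text \<open>
  The inertia is certified in the spirit of Sylvester's law: a real symmetric matrix has at least
  \<open>k\<close> positive (negative) eigenvalues, counted with multiplicity, whenever its quadratic form is
  positive (negative) definite on a \<open>k\<close>-dimensional space. For the line graph, 26 pairwise
  orthogonal vectors of positive norm and 24 of negative norm account for all 50 eigenvalues.

  The graph has exactly three cycles, of lengths 4, 5 and 5, and they are pairwise edge-disjoint.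
  Hence each of the eight elements of the cycle space is a sum of some of them, and apart from
  these three cycles every nonzero element has at least 9 edges. Any other basis of the cycle
  space then has total length at least 9 + 4 + 4, more than 4 + 5 + 5.
\<close>

section \<open>Counting the eigenvalues of real symmetric matrices\<close>

text \<open>In positive dimension a complex eigenvalue always exists. Moving the symmetric matrix
  \<open>C\<close> across the Hermitian product of an eigenvector with itself gives
  \<open>conjugate c = c\<close>, so \<open>c\<close> is a real root of the real characteristic
  polynomial.\<close>

lemma symmetric_eigenvalue_exists:
  fixes A :: "real mat"
  assumes A: "A \<in> carrier_mat n n" and sym: "transpose_mat A = A" and n: "n > 0"
  shows "\<exists>e. eigenvalue A e"
proof -
  define C where "C = map_mat complex_of_real A"
  have C: "C \<in> carrier_mat n n" using A by (simp add: C_def)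
  have CT: "transpose_mat C = C"
    using sym by (metis C_def map_mat_transpose)
  obtain c where c: "eigenvalue C c"
    using spectrum_non_empty[OF C] n unfolding spectrum_def by auto
  then obtain v where v: "v \<in> carrier_vec n" "v \<noteq> 0\<^sub>v n" "C *\<^sub>v v = c \<cdot>\<^sub>v v"
    using C unfolding eigenvalue_def eigenvector_def by auto
  have "conjugate (C *\<^sub>v v) = C *\<^sub>v conjugate v"
    using A v(1) by (intro eq_vecI) (auto simp: C_def scalar_prod_def sum_conjugate conjugate_dist_mul)
  then have cj: "C *\<^sub>v conjugate v = conjugate c \<cdot>\<^sub>v conjugate v"
    unfolding v(3) by (simp add: conjugate_smult_vec)
  have "(C *\<^sub>v v) \<bullet> conjugate v = v \<bullet> (C *\<^sub>v conjugate v)"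
    using transpose_vec_mult_scalar[OF C, of "conjugate v" v] v(1) CT by simp
  then have "c * (v \<bullet>c v) = conjugate c * (v \<bullet>c v)"
    unfolding v(3) cj using v(1) by simp
  moreover have "v \<bullet>c v \<noteq> 0"
    using v(1,2) by simp
  ultimately have "conjugate c = c" by simp
  then have "complex_of_real (Re c) = c"
    by (simp add: complex_eq_iff)
  moreover have "poly (char_poly C) c = 0"
    using c eigenvalue_root_char_poly[OF C] by simp
  ultimately have "complex_of_real (poly (char_poly A) (Re c)) = 0"
    using of_real_hom.char_poly_hom[OF A, where 'a=complex] unfolding C_def
    by (metis of_real_hom.poly_map_poly)
  then show ?thesis
    using eigenvalue_root_char_poly[OF A] by auto
qed

text \<open>Extend \<open>v\<close> to a basis, orthogonalise, normalise. Gram-Schmidt leaves the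
  first vector unchanged, so column 0 stays a multiple of \<open>v\<close>.\<close>

lemma orthonormal_basis_completion:
  fixes v :: "real vec"
  assumes v: "v \<in> carrier_vec n" "v \<noteq> 0\<^sub>v n"
  obtains U c where "U \<in> carrier_mat n n" "transpose_mat U * U = 1\<^sub>m n" "col U 0 = c \<cdot>\<^sub>v v"
proof -
  interpret cof_vec_space n "TYPE(real)" .
  define b where "b = basis_completion v"
  have b: "distinct b" "\<not> lin_dep (set b)" "set b \<subseteq> carrier_vec n" "hd b = v" "length b = n"
    using basis_completion[OF v, folded b_def] by auto
  have n: "n > 0"
    using v by (cases n) auto
  then obtain vs where vs: "b = v # vs"
    using b(4,5) by (cases b) auto
  define ws where "ws = gram_schmidt n b"
  have ws: "set ws \<subseteq> carrier_vec n" "corthogonal ws" "length ws = n"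
    using gram_schmidt_result[OF b(3,1,2) refl, folded ws_def] b(5) by auto
  have hd_ws: "hd ws = v"
    using gram_schmidt_hd[OF v(1), of vs, folded vs] by (simp add: ws_def)
  define us where "us = map (\<lambda>w. (1 / sqrt (w \<bullet> w)) \<cdot>\<^sub>v w) ws"
  define U where "U = mat_of_cols n us"
  have us: "us ! i = (1 / sqrt (ws ! i \<bullet> ws ! i)) \<cdot>\<^sub>v (ws ! i)" "ws ! i \<in> carrier_vec n"
    if "i < n" for i
    using that ws(1,3) by (auto simp: us_def)
  have col: "col U i = us ! i" if "i < n" for i
    using that us[OF that] ws(3) by (simp add: U_def us_def)
  have car: "U \<in> carrier_mat n n"
    using ws(3) mat_of_cols_carrier(1)[of n us] by (simp add: U_def us_def)
  have "us ! i \<bullet> us ! j = of_bool (i = j)" if ij: "i < n" "j < n" for i j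
  proof -
    \<comment> \<open>\<open>corthogonal\<close> also says that no vector has norm zero, which makes
      the normalisation legitimate.\<close>
    have "ws ! i \<bullet> ws ! j = 0 \<longleftrightarrow> i \<noteq> j"
      using corthogonalD[OF ws(2), of i j] ij ws(3) by simp
    moreover have "ws ! i \<bullet> ws ! i \<ge> 0"
      using conjugate_square_ge_0_vec[of "ws ! i"] by simp
    ultimately show ?thesis
      using us[OF ij(1)] us[OF ij(2)] by (auto simp: field_simps)
  qed
  then have "transpose_mat U * U = 1\<^sub>m n"
    using car col by (intro eq_matI) auto
  moreover have "col U 0 = (1 / sqrt (ws ! 0 \<bullet> ws ! 0)) \<cdot>\<^sub>v v"
    using col us n hd_ws ws(3) by (metis hd_conv_nth length_0_conv less_irrefl)
  ultimately show ?thesis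
    using that car by blast
qed

text \<open>Deflation: in an orthonormal basis that starts with an eigenvector, the first column is
  \<open>e\<close> times a unit vector, by symmetry so is the first row, and the induction
  hypothesis diagonalises the remaining block.\<close>

theorem real_spectral_theorem:
  fixes A :: "real mat"
  assumes "A \<in> carrier_mat n n" "transpose_mat A = A"
  shows "\<exists>P. P \<in> carrier_mat n n \<and> transpose_mat P * P = 1\<^sub>m n \<and>
    diagonal_mat (transpose_mat P * A * P)"
  using assms
proof (induction n arbitrary: A)
  case 0
  then show ?case
    by (intro exI[of _ "1\<^sub>m 0"]) (auto simp: diagonal_mat_def)
next
  case (Suc n)
  let ?N = "Suc n"
  note A = Suc.prems
  obtain e where "eigenvalue A e"
    using symmetric_eigenvalue_exists[OF A] by auto
  then obtain v where v: "v \<in> carrier_vec ?N" "v \<noteq> 0\<^sub>v ?N" "A *\<^sub>v v = e \<cdot>\<^sub>v v"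
    using A unfolding eigenvalue_def eigenvector_def by auto
  obtain U c where U: "U \<in> carrier_mat ?N ?N" "transpose_mat U * U = 1\<^sub>m ?N" "col U 0 = c \<cdot>\<^sub>v v"
    using orthonormal_basis_completion[OF v(1,2)] .
  have UT: "transpose_mat U \<in> carrier_mat ?N ?N" using U by simp
  define B where "B = transpose_mat U * A * U"
  have B: "B \<in> carrier_mat ?N ?N" using U A by (simp add: B_def)
  have BT: "transpose_mat B = B"
    using U A unfolding B_def
    by (simp add: transpose_mult[of _ ?N ?N _ ?N] assoc_mult_mat[of _ ?N ?N _ ?N _ ?N])
  have "col B 0 = e \<cdot>\<^sub>v unit_vec ?N 0"
  proof -
    have "col B 0 = transpose_mat U *\<^sub>v (A *\<^sub>v col U 0)"
      using U(1) UT A unfolding B_def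
      by (simp add: assoc_mult_mat[of _ ?N ?N _ ?N _ ?N] col_mult2[of _ ?N ?N _ ?N] del: col_mult)
    also have "A *\<^sub>v col U 0 = e \<cdot>\<^sub>v col U 0"
      unfolding U(3) using A v
      by (simp add: mult_mat_vec[of _ ?N ?N] smult_smult_assoc mult.commute)
    also have "transpose_mat U *\<^sub>v (e \<cdot>\<^sub>v col U 0) = e \<cdot>\<^sub>v (transpose_mat U *\<^sub>v col U 0)"
      using UT U(1) by (intro mult_mat_vec[of _ ?N ?N] carrier_vecI) auto
    also have "transpose_mat U *\<^sub>v col U 0 = col (transpose_mat U * U) 0"
      using UT U(1) by (simp add: col_mult2[of _ ?N ?N _ ?N] del: col_mult)
    finally show ?thesis unfolding U(2) by simp
  qed
  then have B0: "B $$ (i, 0) = (if i = 0 then e else 0)" if "i < ?N" for i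
    using that B by (metis carrier_matD col_def index_smult_vec(1) index_unit_vec(1,3) index_vec
        mult.right_neutral mult_zero_right zero_less_Suc)
  then have B0': "B $$ (0, i) = (if i = 0 then e else 0)" if "i < ?N" for i
    using that B BT by (metis carrier_matD index_transpose_mat(1) zero_less_Suc)
  define B3 where "B3 = mat n n (\<lambda>(i, j). B $$ (Suc i, Suc j))"
  have B3: "B3 \<in> carrier_mat n n" by (simp add: B3_def)
  have "B $$ (i, j) = B $$ (j, i)" if "i < ?N" "j < ?N" for i j
    using that B BT by (metis carrier_matD index_transpose_mat(1))
  then have B3T: "transpose_mat B3 = B3"
    by (intro eq_matI) (auto simp: B3_def)
  have Bblock: "B = four_block_mat (mat 1 1 (\<lambda>_. e)) (0\<^sub>m 1 n) (0\<^sub>m n 1) B3"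
    using B B0 B0' by (intro eq_matI) (auto simp: B3_def)
  obtain Q where Q: "Q \<in> carrier_mat n n" "transpose_mat Q * Q = 1\<^sub>m n"
      "diagonal_mat (transpose_mat Q * B3 * Q)"
    using Suc.IH[OF B3 B3T] by auto
  \<comment> \<open>\<open>F\<close> fixes the first coordinate and acts as \<open>Q\<close> on the
    others, so conjugating by it keeps the corner \<open>e\<close> and diagonalises the block
    \<open>B3\<close>.\<close>
  define F where "F = four_block_mat (1\<^sub>m 1) (0\<^sub>m 1 n) (0\<^sub>m n 1) Q"
  have F: "F \<in> carrier_mat ?N ?N"
    using four_block_carrier_mat[OF one_carrier_mat[of 1] Q(1)] by (simp add: F_def)
  have FT: "transpose_mat F = four_block_mat (1\<^sub>m 1) (0\<^sub>m 1 n) (0\<^sub>m n 1) (transpose_mat Q)"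
    using Q by (simp add: F_def transpose_four_block_mat[of _ 1 1 _ n _ n] del: One_nat_def)
  have FF: "transpose_mat F * F = 1\<^sub>m ?N"
    unfolding FT using Q
    by (simp add: F_def mult_four_block_mat[of _ 1 1 _ n _ n _ _ 1 _ n] four_block_one_mat)
  have "transpose_mat F * B * F =
      four_block_mat (mat 1 1 (\<lambda>_. e)) (0\<^sub>m 1 n) (0\<^sub>m n 1) (transpose_mat Q * B3 * Q)"
    unfolding FT Bblock using Q B3
    by (simp add: F_def mult_four_block_mat[of _ 1 1 _ n _ n _ _ 1 _ n] del: One_nat_def)
  then have D: "diagonal_mat (transpose_mat F * B * F)"
    using Q B3 by (auto simp: diagonal_mat_def)
  let ?P = "U * F"
  have "transpose_mat ?P * ?P = transpose_mat F * (transpose_mat U * U) * F"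
    using U(1) UT F by (simp add: transpose_mult[of _ ?N ?N _ ?N] assoc_mult_mat[of _ ?N ?N _ ?N _ ?N])
  then have "transpose_mat ?P * ?P = 1\<^sub>m ?N"
    unfolding U(2) using F FF by simp
  moreover have "transpose_mat ?P * A * ?P = transpose_mat F * B * F"
    using U(1) UT F A by (simp add: B_def transpose_mult[of _ ?N ?N _ ?N] assoc_mult_mat[of _ ?N ?N _ ?N _ ?N])
  ultimately show ?case
    using D U(1) F by (intro exI[of _ ?P]) auto
qed

section \<open>Eigenvalue counts and quadratic forms\<close>

lemma order_linear_factors:
  fixes x :: "'a::idom"
  shows "order x (\<Prod>a\<leftarrow>as. [:- a, 1:]) = count_list as x"
proof (induction as)
  case Nil
  then show ?case by (simp add: order_1_eq_0)
next
  case (Cons a as)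
  have "(\<Prod>a\<leftarrow>as. [:- a, 1:]) \<noteq> 0"
    by (simp add: prod_list_zero_iff image_iff)
  then have "[:- a, 1:] * (\<Prod>a\<leftarrow>as. [:- a, 1:]) \<noteq> 0"
    by (simp del: mult_pCons_left)
  then have "order x (\<Prod>a\<leftarrow>a # as. [:- a, 1:]) = order x [:- a, 1:] + order x (\<Prod>a\<leftarrow>as. [:- a, 1:])"
    using order_mult[of "[:- a, 1:]"] by (simp del: mult_pCons_left)
  also have "order x [:- a, 1:] = of_bool (a = x)"
    using order_power_n_n[of a 1] order_0I[of "[:- a, 1:]" x] by (cases "a = x") auto
  finally show ?case
    using Cons.IH by (simp del: mult_pCons_left)
qed

text \<open>Once the characteristic polynomial splits, summing orders over the distinct eigenvalues
  amounts to counting entries in the list of roots.\<close>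

lemma eigenvalue_count_linear_factors:
  assumes A: "A \<in> carrier_mat n n" and as: "char_poly A = (\<Prod>a\<leftarrow>as. [:- a, 1:])"
  shows "eigenvalue_count A Q = length (filter Q as)"
proof -
  have "{x. eigenvalue A x \<and> Q x} = set (filter Q as)"
    unfolding eigenvalue_root_char_poly[OF A] as
    by (auto simp: poly_prod_list prod_list_zero_iff image_iff)
  moreover have "count_list as x = count_list (filter Q as) x" if "Q x" for x
    using that by (induction as) auto
  then have "sum (count_list as) (set (filter Q as)) = sum (count_list (filter Q as)) (set (filter Q as))"
    by (intro sum.cong) auto
  ultimately show ?thesis
    unfolding eigenvalue_count_def as order_linear_factors by (simp only: sum_count_set order_refl finite_set)
qed

text \<open>\<open>adjacency_matrix\<close> enumerates the vertices by an unspecified choice, so it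
  is accessible through its characteristic polynomial; this transfers the count to a concrete
  matrix.\<close>

lemma eigenvalue_count_cong_char_poly:
  assumes "A \<in> carrier_mat n n" "B \<in> carrier_mat m m" "char_poly A = char_poly B"
  shows "eigenvalue_count A Q = eigenvalue_count B Q"
  using assms unfolding eigenvalue_count_def by (simp add: eigenvalue_root_char_poly)

lemma diagonal_mat_quadratic_form:
  fixes D :: "'a::comm_semiring_1 mat"
  assumes D: "D \<in> carrier_mat n n" "diagonal_mat D" and z: "z \<in> carrier_vec n"
  shows "z \<bullet> (D *\<^sub>v z) = (\<Sum>i<n. D $$ (i, i) * (z $ i)\<^sup>2)"
proof -
  have "z \<bullet> (D *\<^sub>v z) = (\<Sum>i<n. z $ i * (\<Sum>j<n. D $$ (i, j) * z $ j))"
    using D z by (simp add: scalar_prod_def lessThan_atLeast0)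
  also have "\<dots> = (\<Sum>i<n. D $$ (i, i) * (z $ i)\<^sup>2)"
  proof (rule sum.cong[OF refl])
    fix i assume "i \<in> {..<n}"
    then have i: "i < n" by simp
    have "(\<Sum>j<n. D $$ (i, j) * z $ j) = (\<Sum>j<n. if j = i then D $$ (i, i) * z $ i else 0)"
      using D i by (intro sum.cong) (auto simp: diagonal_mat_def)
    also have "\<dots> = D $$ (i, i) * z $ i"
      using i by simp
    finally show "z $ i * (\<Sum>j<n. D $$ (i, j) * z $ j) = D $$ (i, i) * (z $ i)\<^sup>2"
      by (simp add: power2_eq_square ac_simps)
  qed
  finally show ?thesis .
qed

text \<open>For an orthogonal matrix, congruence and similarity coincide, so one list
  \<open>es\<close> gives both the roots of the characteristic polynomial and the weights in the sum
  of squares. The \<open>P\<close> handed out is the transpose of the one from the spectral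
  theorem.\<close>

lemma symmetric_matrix_diagonalisation:
  fixes A :: "real mat"
  assumes A: "A \<in> carrier_mat n n" and sym: "transpose_mat A = A"
  obtains P es where "P \<in> carrier_mat n n" "length es = n"
    "char_poly A = (\<Prod>e\<leftarrow>es. [:- e, 1:])"
    "\<And>x. x \<in> carrier_vec n \<Longrightarrow> x \<bullet> (A *\<^sub>v x) = (\<Sum>i<n. es ! i * ((P *\<^sub>v x) $ i)\<^sup>2)"
proof -
  obtain P where P: "P \<in> carrier_mat n n" "transpose_mat P * P = 1\<^sub>m n"
      "diagonal_mat (transpose_mat P * A * P)"
    using real_spectral_theorem[OF assms] by auto
  have PT: "transpose_mat P \<in> carrier_mat n n" using P by simp
  define D where "D = transpose_mat P * A * P"
  have D: "D \<in> carrier_mat n n" using P A by (simp add: D_def)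
  have PP: "P * transpose_mat P = 1\<^sub>m n"
    by (rule mat_mult_left_right_inverse[OF PT P(1,2)])
  have "P * D * transpose_mat P = (P * transpose_mat P) * A * (P * transpose_mat P)"
    using P(1) PT A by (simp add: D_def assoc_mult_mat[of _ n n _ n _ n])
  then have APD: "A = P * D * transpose_mat P"
    unfolding PP using A by simp
  then have "similar_mat A D"
    using A D P PT PP by (intro similar_matI[of _ _ P "transpose_mat P" n]) auto
  then have "char_poly A = char_poly D"
    by (rule char_poly_similar)
  also have "\<dots> = (\<Prod>e\<leftarrow>diag_mat D. [:- e, 1:])"
    using P(3) D by (intro char_poly_upper_triangular[of _ n]) (auto simp: D_def[symmetric] diagonal_mat_def)
  finally have cp: "char_poly A = (\<Prod>e\<leftarrow>diag_mat D. [:- e, 1:])" .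
  have "x \<bullet> (A *\<^sub>v x) = (\<Sum>i<n. diag_mat D ! i * ((transpose_mat P *\<^sub>v x) $ i)\<^sup>2)"
    if x: "x \<in> carrier_vec n" for x
  proof -
    define z where "z = transpose_mat P *\<^sub>v x"
    have z: "z \<in> carrier_vec n" using PT x by (simp add: z_def)
    have "A *\<^sub>v x = P *\<^sub>v (D *\<^sub>v z)"
      unfolding APD z_def using P(1) PT D x by (simp add: assoc_mult_mat_vec[of _ n n _ n])
    then have "x \<bullet> (A *\<^sub>v x) = z \<bullet> (D *\<^sub>v z)"
      using transpose_vec_mult_scalar[OF P(1), of "D *\<^sub>v z" x] D z x by (simp add: z_def)
    also have "\<dots> = (\<Sum>i<n. D $$ (i, i) * (z $ i)\<^sup>2)"
      using diagonal_mat_quadratic_form[OF D _ z] P(3) by (simp add: D_def)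
    also have "\<dots> = (\<Sum>i<n. diag_mat D ! i * (z $ i)\<^sup>2)"
      using D by (simp add: diag_mat_def)
    finally show ?thesis by (simp add: z_def)
  qed
  moreover have "length (diag_mat D) = n"
    using D by (simp add: diag_mat_def)
  ultimately show ?thesis
    using that[OF PT _ cp] by blast
qed

text \<open>All \<open>n\<close> roots are real. This turns lower bounds on the positive and
  negative counts that add up to \<open>n\<close> into equalities.\<close>

lemma eigenvalue_count_trichotomy:
  fixes A :: "real mat"
  assumes A: "A \<in> carrier_mat n n" "transpose_mat A = A"
  shows "eigenvalue_count A (\<lambda>x. x > 0) + eigenvalue_count A (\<lambda>x. x = 0) +
    eigenvalue_count A (\<lambda>x. x < 0) = n"
proof -
  obtain es where es: "length es = n" "char_poly A = (\<Prod>e\<leftarrow>es. [:- e, 1:])"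
    using symmetric_matrix_diagonalisation[OF A] by blast
  have "length (filter (\<lambda>x. x > 0) es) + length (filter (\<lambda>x. x = 0) es) +
      length (filter (\<lambda>x. x < 0) es) = length es"
    by (induction es) auto
  then show ?thesis
    unfolding eigenvalue_count_linear_factors[OF A(1) es(2)] es(1) .
qed

text \<open>Dimension count: with fewer than \<open>k\<close> eigenvalues of sign \<open>s\<close>,
  making the corresponding coordinates vanish imposes fewer than \<open>k\<close> linear conditions
  on \<open>y\<close>. A nonzero \<open>y\<close> survives, and there \<open>s\<close> times the
  form is a sum of nonpositive terms. The factor \<open>s\<close> treats both signs at once.\<close>

lemma definite_subspace_dim_le_eigenvalue_count:
  fixes A V :: "real mat" and s :: real
  assumes A: "A \<in> carrier_mat n n" "transpose_mat A = A" and V: "V \<in> carrier_mat n k"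
    and definite: "\<And>y. y \<in> carrier_vec k \<Longrightarrow> y \<noteq> 0\<^sub>v k \<Longrightarrow>
      0 < s * ((V *\<^sub>v y) \<bullet> (A *\<^sub>v (V *\<^sub>v y)))"
  shows "k \<le> eigenvalue_count A (\<lambda>x. 0 < s * x)"
proof (rule ccontr)
  obtain P es where P: "P \<in> carrier_mat n n" and es: "length es = n"
      "char_poly A = (\<Prod>e\<leftarrow>es. [:- e, 1:])"
    and form: "\<And>x. x \<in> carrier_vec n \<Longrightarrow> x \<bullet> (A *\<^sub>v x) = (\<Sum>i<n. es ! i * ((P *\<^sub>v x) $ i)\<^sup>2)"
    using symmetric_matrix_diagonalisation[OF A] by blast
  \<comment> \<open>Positions are recorded instead of values, since equal eigenvalues belong to
    different rows of \<open>R\<close>.\<close>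
  define idx where "idx = filter (\<lambda>i. 0 < s * es ! i) [0..<n]"
  define p where "p = length idx"
  have "filter (\<lambda>x. 0 < s * x) es = map ((!) es) idx"
    using es(1) map_nth[of es] unfolding idx_def by (metis (mono_tags, lifting) comp_apply filter_cong filter_map)
  then have "eigenvalue_count A (\<lambda>x. 0 < s * x) = p"
    unfolding eigenvalue_count_linear_factors[OF A(1) es(2)] p_def by simp
  moreover assume "\<not> k \<le> eigenvalue_count A (\<lambda>x. 0 < s * x)"
  ultimately have pk: "p < k" by simp
  define R where "R = P * V"
  have R: "R \<in> carrier_mat n k" using P V by (simp add: R_def)
  \<comment> \<open>Zero rows turn the \<open>p < k\<close> linear conditions on \<open>y\<close> into a singular square system.\<close>
  define M where "M = mat\<^sub>r k k (\<lambda>i. if i = p then 0\<^sub>v k else if i < p then row R (idx ! i) else 0\<^sub>v k)"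
  have M: "M \<in> carrier_mat k k" by (simp add: M_def)
  have "det M = 0"
    unfolding M_def using pk R by (intro det_row_0) auto
  then obtain y where y: "y \<in> carrier_vec k" "y \<noteq> 0\<^sub>v k" "M *\<^sub>v y = 0\<^sub>v k"
    using det_0_iff_vec_prod_zero[OF M] by auto
  have zero: "(R *\<^sub>v y) $ i = 0" if i: "i < n" "0 < s * es ! i" for i
  proof -
    have "i \<in> set idx"
      using i by (simp add: idx_def)
    then obtain j where j: "j < p" "idx ! j = i"
      unfolding p_def in_set_conv_nth by blast
    have "(M *\<^sub>v y) $ j = row R i \<bullet> y"
      using j pk R by (simp add: M_def)
    then show ?thesis
      using y j pk R i by simp
  qed
  have x: "V *\<^sub>v y \<in> carrier_vec n" "P *\<^sub>v (V *\<^sub>v y) = R *\<^sub>v y"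
    using V y P by (auto simp: R_def assoc_mult_mat_vec[of _ n n _ k])
  have "s * ((V *\<^sub>v y) \<bullet> (A *\<^sub>v (V *\<^sub>v y))) = (\<Sum>i<n. s * es ! i * ((R *\<^sub>v y) $ i)\<^sup>2)"
    unfolding form[OF x(1)] x(2) by (simp add: sum_distrib_left mult.assoc)
  also have "\<dots> \<le> 0"
  proof (rule sum_nonpos)
    fix i assume "i \<in> {..<n}"
    then show "s * es ! i * ((R *\<^sub>v y) $ i)\<^sup>2 \<le> 0"
      using zero[of i] by (cases "0 < s * es ! i") (auto simp: mult_nonpos_nonneg)
  qed
  finally show False
    using definite[OF y(1,2)] by simp
qed

section \<open>Integer certificates for eigenvalue counts\<close>

definition coefficient :: "('e \<times> int) list \<Rightarrow> 'e \<Rightarrow> int" where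
  "coefficient c e = (\<Sum>(f, a)\<leftarrow>c. if f = e then a else 0)"

text \<open>This is the bilinear form of the adjacency matrix of \<open>r\<close>, for vectors
  stored as association lists in which repeated keys add up. Lists of integers make it evaluable
  without building a matrix.\<close>

definition sparse_form :: "('e \<Rightarrow> 'e \<Rightarrow> bool) \<Rightarrow> ('e \<times> int) list \<Rightarrow> ('e \<times> int) list \<Rightarrow> int" where
  "sparse_form r c d = (\<Sum>(e, a)\<leftarrow>c. \<Sum>(f, b)\<leftarrow>d. if r e f then a * b else 0)"

text \<open>Bridge from a dense sum over all coordinates to a sparse one. As \<open>es\<close> is
  distinct and contains every key, each entry of \<open>c\<close> is picked up exactly once.\<close>

lemma sum_coefficient:
  assumes "distinct es" "fst ` set c \<subseteq> set es"
  shows "(\<Sum>i<length es. coefficient c (es ! i) * g (es ! i)) = (\<Sum>(e, a)\<leftarrow>c. a * g e)"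
proof -
  have "(\<Sum>i<length es. coefficient c (es ! i) * g (es ! i)) = (\<Sum>e\<in>set es. coefficient c e * g e)"
    by (rule sum.reindex_bij_betw[OF bij_betw_nth[OF assms(1) refl refl]])
  also have "\<dots> = (\<Sum>(e, a)\<leftarrow>c. a * g e)"
    using assms(2)
  proof (induction c)
    case Nil
    then show ?case by (simp add: coefficient_def)
  next
    case (Cons x c)
    obtain f a where x: "x = (f, a)" by force
    have "(\<Sum>e\<in>set es. coefficient (x # c) e * g e) =
        (\<Sum>e\<in>set es. (if e = f then a * g e else 0) + coefficient c e * g e)"
      by (intro sum.cong) (auto simp: coefficient_def x distrib_right)
    also have "\<dots> = a * g f + (\<Sum>e\<in>set es. coefficient c e * g e)"
      using Cons.prems by (simp add: sum.distrib x)
    finally show ?case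
      using Cons by (simp add: x)
  qed
  finally show ?thesis .
qed

text \<open>The Gram matrix \<open>W\<close> of the family is diagonal with diagonal entries of sign
  \<open>s\<close>, so \<open>s\<close> times the form is positive definite on the combinations of
  the family.\<close>

lemma orthogonal_family_le_eigenvalue_count:
  fixes s :: int
  assumes es: "distinct es" and r: "symp r"
    and cs: "\<And>c. c \<in> set cs \<Longrightarrow> fst ` set c \<subseteq> set es"
    and orth: "sorted_wrt (\<lambda>c d. sparse_form r c d = 0) cs"
    and definite: "\<forall>c\<in>set cs. 0 < s * sparse_form r c c"
  defines "A \<equiv> mat (length es) (length es) (\<lambda>(i, j). of_bool (r (es ! i) (es ! j))) :: real mat"
  shows "length cs \<le> eigenvalue_count A (\<lambda>x. 0 < real_of_int s * x)"
proof -
  define n k where "n = length es" and "k = length cs"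
  define V :: "real mat" where "V = mat n k (\<lambda>(i, a). of_int (coefficient (cs ! a) (es ! i)))"
  have V: "V \<in> carrier_mat n k" "transpose_mat V \<in> carrier_mat k n" by (simp_all add: V_def)
  have A: "A \<in> carrier_mat n n" by (simp add: A_def n_def)
  have AT: "transpose_mat A = A"
    using r by (intro eq_matI) (auto simp: A_def symp_def)
  define W where "W = transpose_mat V * (A * V)"
  have W: "W \<in> carrier_mat k k"
    unfolding W_def using V A by (intro mult_carrier_mat[of _ k n] mult_carrier_mat[of _ n n]) auto
  have scale:
    "x * (\<Sum>(f, y)\<leftarrow>d. y * of_bool (r e f)) = (\<Sum>(f, y)\<leftarrow>d. if r e f then x * y else 0)"
    for x e and d :: "('a \<times> int) list"
    by (induction d) (auto simp: distrib_left)
  \<comment> \<open>Two uses of \<open>sum_coefficient\<close>, one per index of the double sum,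
    turn the entry of the matrix product into an evaluable integer.\<close>
  have entry: "W $$ (a, b) = of_int (sparse_form r (cs ! a) (cs ! b))" if "a < k" "b < k" for a b
  proof -
    have cab: "fst ` set (cs ! a) \<subseteq> set es" "fst ` set (cs ! b) \<subseteq> set es"
      using that cs by (simp_all add: k_def)
    have "W $$ (a, b) = (\<Sum>i<n. V $$ (i, a) * (\<Sum>j<n. A $$ (i, j) * V $$ (j, b)))"
      using that V A by (simp add: W_def scalar_prod_def lessThan_atLeast0)
    also have "\<dots> = of_int (\<Sum>i<n. coefficient (cs ! a) (es ! i) *
        (\<Sum>j<n. coefficient (cs ! b) (es ! j) * of_bool (r (es ! i) (es ! j))))"
      using that by (simp add: V_def A_def n_def[symmetric] mult.commute)
    also have "(\<Sum>i<n. coefficient (cs ! a) (es ! i) *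
        (\<Sum>j<n. coefficient (cs ! b) (es ! j) * of_bool (r (es ! i) (es ! j)))) =
        (\<Sum>(e, x)\<leftarrow>cs ! a. x * (\<Sum>(f, y)\<leftarrow>cs ! b. y * of_bool (r e f)))"
      unfolding n_def sum_coefficient[OF es cab(2), of "\<lambda>f. of_bool (r _ f)"]
      by (rule sum_coefficient[OF es cab(1)])
    also have "\<dots> = sparse_form r (cs ! a) (cs ! b)"
      by (simp only: sparse_form_def scale)
    finally show ?thesis .
  qed
  have WT: "transpose_mat W = W"
    using V A AT transpose_mult[of "transpose_mat V" k n "A * V" k] transpose_mult[OF A V(1)]
    by (simp add: W_def assoc_mult_mat[of _ k n _ n _ k])
  have "W $$ (a, b) = 0" if ab: "a < k" "b < k" "a \<noteq> b" for a b
  proof -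
    \<comment> \<open>\<open>sorted_wrt\<close> compares earlier members with later ones; the
      symmetry of \<open>W\<close> supplies the other half.\<close>
    have *: "W $$ (a, b) = 0" if "a < b" "b < k" for a b
      using that entry orth by (simp add: sorted_wrt_iff_nth_less k_def)
    then show ?thesis
      using ab W WT by (metis carrier_matD index_transpose_mat(1) nat_neq_iff)
  qed
  then have diag: "diagonal_mat W"
    using W by (auto simp: diagonal_mat_def)
  have "0 < of_int s * ((V *\<^sub>v y) \<bullet> (A *\<^sub>v (V *\<^sub>v y)))"
    if y: "y \<in> carrier_vec k" "y \<noteq> 0\<^sub>v k" for y
  proof -
    have "(V *\<^sub>v y) \<bullet> (A *\<^sub>v (V *\<^sub>v y)) = y \<bullet> (W *\<^sub>v y)"
      using transpose_vec_mult_scalar[OF V(1) y(1), of "A *\<^sub>v (V *\<^sub>v y)"] V A y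
        comm_scalar_prod[of y k "W *\<^sub>v y"] comm_scalar_prod[of "V *\<^sub>v y" n "A *\<^sub>v (V *\<^sub>v y)"]
      by (simp add: W_def assoc_mult_mat_vec[of _ k n _ k] assoc_mult_mat_vec[of _ n n _ k])
    also have "\<dots> = (\<Sum>a<k. W $$ (a, a) * (y $ a)\<^sup>2)"
      by (rule diagonal_mat_quadratic_form[OF W diag y(1)])
    finally have eq: "of_int s * ((V *\<^sub>v y) \<bullet> (A *\<^sub>v (V *\<^sub>v y))) =
        (\<Sum>a<k. of_int (s * sparse_form r (cs ! a) (cs ! a)) * (y $ a)\<^sup>2)"
      by (simp add: entry sum_distrib_left mult.assoc)
    have pos: "0 < real_of_int (s * sparse_form r (cs ! a) (cs ! a))" if "a < k" for a
      using definite that unfolding k_def of_int_0_less_iff by auto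
    obtain a where a: "a < k" "y $ a \<noteq> 0"
      using y by (metis carrier_vecD eq_vecI index_zero_vec)
    show ?thesis
      unfolding eq
    proof (rule sum_pos2[of _ a])
      show "0 < real_of_int (s * sparse_form r (cs ! a) (cs ! a)) * (y $ a)\<^sup>2"
        using pos[OF a(1)] a(2) by (simp del: of_int_mult)
      show "0 \<le> real_of_int (s * sparse_form r (cs ! i) (cs ! i)) * (y $ i)\<^sup>2" if "i \<in> {..<k}" for i
        using pos[of i] that by (intro mult_nonneg_nonneg) auto
    qed (use a in auto)
  qed
  then show ?thesis
    unfolding k_def[symmetric] by (rule definite_subspace_dim_le_eigenvalue_count[OF A AT V(1)])
qed

section \<open>The inertia of the line graph\<close>

definition edge_list :: "(nat \<times> nat) list" where
  "edge_list =
    [(0,1), (0,2), (0,3), (1,5), (1,12), (1,13), (2,12), (3,16), (3,24), (4,5), (4,6), (5,7),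
    (5,8), (6,31), (7,25), (9,10), (9,11), (11,14), (11,15), (13,22), (13,28), (14,26), (15,27),
    (16,17), (17,29), (17,30), (18,19), (19,20), (20,31), (21,22), (21,23), (24,43), (25,26),
    (26,27), (28,32), (29,37), (30,38), (30,39), (32,46), (33,34), (33,35), (34,36), (36,43),
    (37,39), (38,40), (38,41), (40,42), (41,44), (44,45), (46,47)]"

definition edge_of :: "'a \<times> 'a \<Rightarrow> 'a set" where
  "edge_of = (\<lambda>(u, v). {u, v})"

text \<open>Adjacency in the line graph, on ordered pairs so that evaluation compares numbers and
  not sets. A pair and its reversal count as incident, so the match with the line graph relies on
  each edge being listed in one orientation.\<close>

definition incident :: "'a \<times> 'a \<Rightarrow> 'a \<times> 'a \<Rightarrow> bool" where
  "incident = (\<lambda>(u, v) (x, y). (u = x \<or> u = y \<or> v = x \<or> v = y) \<and> (u, v) \<noteq> (x, y))"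

text \<open>
  The two families come from a diagonalisation of the adjacency matrix of the line graph by
  congruence, in which each pivot is either a diagonal entry or a hyperbolic pair of adjacent edges,
  followed by clearing denominators.
\<close>

definition positive_family :: "((nat \<times> nat) \<times> int) list list" where
  "positive_family = [
      [((18,19), 1), ((19,20), 1)],
      [((21,22), 1), ((21,23), 1)],
      [((33,34), 1), ((33,35), 1)],
      [((38,40), 1), ((40,42), 1)],
      [((6,31), 1), ((18,19), -1), ((20,31), 1)],
      [((32,46), 1), ((46,47), 1)],
      [((41,44), 1), ((44,45), 1)],
      [((33,35), -1), ((34,36), 1), ((36,43), 1)],
      [((13,22), 1), ((13,28), 1), ((21,23), -1)],
      [((16,17), 1), ((17,29), 1)],
      [((4,5), 1), ((5,8), 1)],
      [((15,27), 1), ((26,27), 1)],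
      [((9,10), 1), ((9,11), 1)],
      [((30,39), 1), ((37,39), 1)],
      [((0,2), 1), ((0,3), 1)],
      [((9,10), -1), ((11,14), 1), ((14,26), 1), ((15,27), -1)],
      [((9,10), 2), ((11,14), -1), ((11,15), -1), ((14,26), 1), ((15,27), -1), ((26,27), 1)],
      [((30,38), 1), ((37,39), -1), ((38,41), 1), ((40,42), -2), ((44,45), -1)],
      [((0,3), -1), ((1,12), 1), ((2,12), 1)],
      [((16,17), -1), ((17,29), 1), ((17,30), -1), ((29,37), 2), ((30,39), -2), ((37,39), 1),
      ((38,41), 3), ((40,42), -3), ((44,45), -3)],
      [((0,2), -1), ((1,12), 1), ((3,24), 1), ((24,43), 1), ((33,35), 1), ((34,36), -1)],
      [((4,5), 1), ((4,6), 3), ((5,7), -1), ((5,8), -2), ((18,19), 3), ((20,31), -3)],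
      [((4,6), 2), ((5,8), -2), ((7,25), 2), ((9,10), -1), ((11,15), 1), ((14,26), -1), ((18,19),
      2), ((20,31), -2), ((25,26), 1), ((26,27), -1)],
      [((0,1), 1), ((0,2), -1), ((0,3), 1), ((1,12), 1), ((1,13), 1), ((2,12), -2), ((13,22),
      -1), ((13,28), -1), ((21,23), 1), ((24,43), -1), ((33,35), -1), ((34,36), 1)],
      [((0,1), 2), ((0,2), -2), ((1,5), 1), ((1,12), 2), ((1,13), -1), ((2,12), -2), ((4,6), 3),
      ((5,7), -1), ((5,8), -3), ((7,25), 2), ((9,10), -1), ((11,15), 1), ((13,22), -6), ((13,28),
      1), ((14,26), -1), ((18,19), 3), ((20,31), -3), ((21,23), 6), ((25,26), 1), ((26,27), -1),
      ((28,32), 7), ((46,47), -7)],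
      [((0,1), -1), ((0,2), -1), ((1,12), 1), ((2,12), 1), ((3,16), 2), ((16,17), 1), ((17,29),
      -1), ((17,30), -1), ((24,43), -2), ((33,35), -2), ((34,36), 2), ((37,39), 1), ((38,41), 1),
      ((40,42), -1), ((44,45), -1)]]"

definition negative_family :: "((nat \<times> nat) \<times> int) list list" where
  "negative_family = [
      [((18,19), -1), ((19,20), 1)],
      [((21,22), -1), ((21,23), 1)],
      [((33,34), 1), ((33,35), -1)],
      [((38,40), 1), ((40,42), -1)],
      [((6,31), 1), ((18,19), 1), ((20,31), -1)],
      [((32,46), -1), ((46,47), 1)],
      [((41,44), 1), ((44,45), -1)],
      [((33,35), 1), ((34,36), -1), ((36,43), 1)],
      [((13,22), 1), ((13,28), -1), ((21,23), -1)],
      [((16,17), -1), ((17,29), 1)],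
      [((4,5), 1), ((5,8), -1)],
      [((15,27), -1), ((26,27), 1)],
      [((9,10), 1), ((9,11), -1)],
      [((30,39), -1), ((37,39), 1)],
      [((0,2), -1), ((0,3), 1)],
      [((9,10), -1), ((11,14), 1), ((14,26), -1), ((15,27), 1)],
      [((9,10), -1), ((11,15), 1), ((14,26), -1), ((25,26), 1), ((26,27), -1)],
      [((30,38), -1), ((37,39), 1), ((38,41), 1), ((44,45), -1)],
      [((0,3), 1), ((1,12), 1), ((2,12), -1)],
      [((16,17), -2), ((17,29), -1), ((17,30), 1), ((29,37), 1), ((30,39), -1), ((37,39), -1)],
      [((0,2), 1), ((1,12), -1), ((3,24), -1), ((24,43), 1), ((33,35), 1), ((34,36), -1)],
      [((4,5), -1), ((4,6), 1), ((5,7), 1), ((5,8), -2), ((18,19), 1), ((20,31), -1)],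
      [((0,3), -1), ((1,13), -1), ((2,12), 1), ((13,22), 1), ((13,28), 1), ((21,23), -1),
      ((24,43), 1), ((33,35), 1), ((34,36), -1)],
      [((0,1), -1), ((0,2), 1), ((1,5), 1), ((1,12), -1), ((1,13), -1), ((2,12), 1), ((4,6), 3),
      ((5,7), -1), ((5,8), -3), ((7,25), 2), ((9,10), -1), ((11,15), 1), ((13,28), 1), ((14,26),
      -1), ((18,19), 3), ((20,31), -3), ((25,26), 1), ((26,27), -1), ((28,32), 1), ((46,47), -1)]]"

text \<open>A finite evaluation. The factor \<open>1\<close> here, like \<open>- 1\<close> for the
  negative family, is the sign \<open>s\<close> of
  \<open>orthogonal_family_le_eigenvalue_count\<close>.\<close>

lemma positive_family:
  "length positive_family = 26"
  "\<forall>c\<in>set positive_family. fst ` set c \<subseteq> set edge_list"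
  "\<forall>c\<in>set positive_family. 0 < 1 * sparse_form incident c c"
  "sorted_wrt (\<lambda>c d. sparse_form incident c d = 0) positive_family"
  by code_simp+

lemma negative_family:
  "length negative_family = 24"
  "\<forall>c\<in>set negative_family. fst ` set c \<subseteq> set edge_list"
  "\<forall>c\<in>set negative_family. 0 < - 1 * sparse_form incident c c"
  "sorted_wrt (\<lambda>c d. sparse_form incident c d = 0) negative_family"
  by code_simp+

lemma edges_line_graph_iff:
  "{e, f} \<in> edges (line_graph G) \<longleftrightarrow> e \<in> edges G \<and> f \<in> edges G \<and> e \<noteq> f \<and> e \<inter> f \<noteq> {}"
  unfolding line_graph_def by (auto simp: doubleton_eq_iff)

lemma edges_G48: "edges G48 = set (map edge_of edge_list)"
  unfolding G48_def edge_list_def edge_of_def by simp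

text \<open>The list has as many entries as the graph has edges. Hence \<open>edge_of\<close> is
  injective on it, and no edge occurs in both orientations.\<close>

lemma distinct_edge_list: "distinct (map edge_of edge_list)"
  using card_edges_G48 unfolding edges_G48
  by (intro card_distinct) (simp add: edge_list_def)

lemma adjacency_matrix_line_graph_G48:
  "adjacency_matrix_wrt (map edge_of edge_list) (line_graph G48) =
    mat (length edge_list) (length edge_list)
      (\<lambda>(i, j). of_bool (incident (edge_list ! i) (edge_list ! j)))"
proof -
  let ?es = edge_list
  have "{edge_of (?es ! i), edge_of (?es ! j)} \<in> edges (line_graph G48) \<longleftrightarrow>
      incident (?es ! i) (?es ! j)" if ij: "i < length ?es" "j < length ?es" for i j
  proof -
    \<comment> \<open>This reconciles the inequality of pairs in \<open>incident\<close> with the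
      inequality of edges in \<open>line_graph\<close>.\<close>
    have "edge_of (?es ! i) = edge_of (?es ! j) \<longleftrightarrow> ?es ! i = ?es ! j"
      using distinct_edge_list ij by (auto simp: distinct_map inj_on_def)
    moreover have "edge_of (?es ! i) \<in> edges G48" "edge_of (?es ! j) \<in> edges G48"
      using ij by (simp_all add: edges_G48)
    ultimately show ?thesis
      unfolding edges_line_graph_iff by (auto simp: incident_def edge_of_def split: prod.splits)
  qed
  then show ?thesis
    unfolding adjacency_matrix_wrt_def by (intro eq_matI) auto
qed

lemma inertia_line_graph_G48: "inertia (line_graph G48) = (26, 0, 24)"
proof -
  define A :: "real mat" where "A = mat (length edge_list) (length edge_list)
      (\<lambda>(i, j). of_bool (incident (edge_list ! i) (edge_list ! j)))"
  have len: "length edge_list = 50" by (simp add: edge_list_def)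
  have A: "A \<in> carrier_mat 50 50" by (simp add: A_def len)
  have symp: "symp (incident :: nat \<times> nat \<Rightarrow> _)" by (auto simp: symp_def incident_def)
  have AT: "transpose_mat A = A"
    by (intro eq_matI) (auto simp: A_def dest: sympD[OF symp])
  have dist: "distinct edge_list"
    using distinct_edge_list by (simp add: distinct_map)
  let ?L = "adjacency_matrix (line_graph G48)"
  have cp: "char_poly ?L = char_poly A"
    using char_poly_adjacency_matrix[OF distinct_edge_list, of "line_graph G48"]
    unfolding adjacency_matrix_line_graph_G48 A_def[symmetric]
    by (simp add: line_graph_def edges_G48)
  have L: "?L \<in> carrier_mat (dim_row ?L) (dim_row ?L)"
    by (simp add: adjacency_matrix_def adjacency_matrix_wrt_def)
  have count: "eigenvalue_count ?L Q = eigenvalue_count A Q" for Q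
    by (rule eigenvalue_count_cong_char_poly[OF L A cp])
  have "26 \<le> eigenvalue_count A (\<lambda>x. x > 0)"
    using orthogonal_family_le_eigenvalue_count[OF dist symp _ positive_family(4,3)] positive_family(1,2)
    unfolding A_def[symmetric] by simp
  moreover have "24 \<le> eigenvalue_count A (\<lambda>x. x < 0)"
    using orthogonal_family_le_eigenvalue_count[OF dist symp _ negative_family(4,3)] negative_family(1,2)
    unfolding A_def[symmetric] by simp
  \<comment> \<open>Since 26 + 24 = 50, both bounds are attained and the eigenvalue 0 does not
    occur.\<close>
  moreover note eigenvalue_count_trichotomy[OF A AT]
  ultimately show ?thesis
    unfolding inertia_def n_pos_def n_zero_def n_neg_def count by simp
qed

section \<open>Connectivity, triangles and degrees\<close>

text \<open>One pass of a reachability search. An edge met before either end is reached is skipped,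
  so the list is passed several times over.\<close>

fun absorb :: "('a \<times> 'a) list \<Rightarrow> 'a set \<Rightarrow> 'a set" where
  "absorb [] S = S"
| "absorb ((u, v) # es) S = absorb es (if u \<in> S \<or> v \<in> S then insert u (insert v S) else S)"

lemma absorb_reachable:
  assumes "edge_of ` set es \<subseteq> edges G" "S \<subseteq> (adjacency G)\<^sup>* `` {r}"
  shows "absorb es S \<subseteq> (adjacency G)\<^sup>* `` {r}"
  using assms
proof (induction es S rule: absorb.induct)
  case (2 u v es S)
  have uv: "(u, v) \<in> adjacency G" "(v, u) \<in> adjacency G"
    using "2.prems"(1) by (auto simp: adjacency_def edge_of_def insert_commute)
  have "insert u (insert v S) \<subseteq> (adjacency G)\<^sup>* `` {r}" if "u \<in> S \<or> v \<in> S"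
    using that uv "2.prems"(2) by (auto intro: rtrancl_into_rtrancl)
  then show ?case
    using 2 by auto
qed simp

lemma connected_G48: "connected_graph G48"
proof -
  let ?R = "(adjacency G48)\<^sup>*"
  have sym: "sym ?R"
    by (intro sym_rtrancl) (auto simp: sym_def adjacency_def insert_commute)
  \<comment> \<open>Five passes over the edges reach every vertex from 0.\<close>
  have "\<forall>v\<in>set [0..<48]. v \<in> absorb (concat (replicate 5 edge_list)) {0}"
    by code_simp
  moreover have "absorb (concat (replicate 5 edge_list)) {0} \<subseteq> ?R `` {0}"
    by (rule absorb_reachable) (auto simp: edges_G48)
  ultimately have reach: "(0, v) \<in> ?R" if "v \<in> verts G48" for v
    using that by (auto simp: G48_def)
  show ?thesis
    unfolding connected_graph_def
  proof (intro conjI ballI)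
    show "(u, v) \<in> ?R" if "u \<in> verts G48" "v \<in> verts G48" for u v
      using symD[OF sym reach[OF that(1)]] reach[OF that(2)] by (rule rtrancl_trans)
  qed (simp add: G48_def)
qed

text \<open>Every edge is listed with its smaller end first, so a triangle would appear as an
  ascending path of two listed edges closed by a third. The final step covers all six orders of the
  three vertices.\<close>

lemma triangle_free_G48: "triangle_free G48"
proof -
  have edge: "(u, v) \<in> set edge_list \<and> u < v \<or> (v, u) \<in> set edge_list \<and> v < u"
    if "{u, v} \<in> edges G48" for u v
  proof -
    have "\<forall>(u, v)\<in>set edge_list. u < v"
      by (simp add: edge_list_def)
    with that show ?thesis
      by (auto simp: edges_G48 edge_of_def doubleton_eq_iff split: prod.splits)
  qed
  have "\<forall>(u, v)\<in>set edge_list. \<forall>(x, w)\<in>set edge_list. v = x \<longrightarrow> (u, w) \<notin> set edge_list"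
    by (simp add: edge_list_def)
  then have no_triangle: "\<not> ((u, v) \<in> set edge_list \<and> (v, w) \<in> set edge_list \<and> (u, w) \<in> set edge_list)" for u v w
    by fast
  show ?thesis
    unfolding triangle_free_def
  proof (intro notI, elim exE conjE)
    fix u v w
    assume "{u, v} \<in> edges G48" "{v, w} \<in> edges G48" "{u, w} \<in> edges G48"
    then show False
      using edge[of u v] edge[of v w] edge[of u w] no_triangle[of u v w] no_triangle[of u w v]
        no_triangle[of v u w] no_triangle[of v w u] no_triangle[of w u v] no_triangle[of w v u]
      by linarith
  qed
qed

definition touches :: "'a \<Rightarrow> 'a \<times> 'a \<Rightarrow> bool" where
  "touches w = (\<lambda>(u, v). w = u \<or> w = v)"

lemma touches_iff: "touches w d \<longleftrightarrow> w \<in> edge_of d"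
  by (cases d) (simp add: touches_def edge_of_def)

lemma vertex_degree_G48: "vertex_degree G48 v = length (filter (touches v) edge_list)"
proof -
  have "{e \<in> edges G48. v \<in> e} = set (map edge_of (filter (touches v) edge_list))"
    by (auto simp: edges_G48 touches_iff)
  moreover have "distinct (map edge_of (filter (touches v) edge_list))"
    using distinct_edge_list by (rule distinct_map_filter)
  ultimately show ?thesis
    unfolding vertex_degree_def by (simp add: distinct_card del: set_map)
qed

lemma max_degree_G48: "max_degree G48 = 4"
proof -
  \<comment> \<open>Vertex 1, with neighbours 0, 5, 12 and 13, attains the bound.\<close>
  have "\<forall>v\<in>set [0..<48]. length (filter (touches v) edge_list) \<le> 4"
    "length (filter (touches 1) edge_list) = 4"
    by code_simp+
  then show ?thesis
    unfolding max_degree_def vertex_degree_G48 by (intro Max_eqI) (auto simp: G48_def intro!: rev_image_eqI[of 1])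
qed

lemma cycle_rank_G48: "cycle_rank G48 = 3"
  unfolding cycle_rank_def card_edges_G48 by (simp add: G48_def)

section \<open>The cycle space\<close>

text \<open>A visited vertex with at most one remaining edge loses it. Removals create new leaves,
  so \<open>vs\<close> may list vertices repeatedly.\<close>

fun prune :: "'a list \<Rightarrow> ('a \<times> 'a) list \<Rightarrow> ('a \<times> 'a) list" where
  "prune [] es = es"
| "prune (v # vs) es = prune vs
     (if length (filter (touches v) es) \<le> 1 then filter (\<lambda>d. \<not> touches v d) es else es)"

text \<open>A vector of even degree everywhere cannot be nonzero on the only remaining edge at a
  vertex, so pruning never deletes an edge of its support.\<close>

lemma prune_cycle_space:
  assumes "finite (edges G)" "x \<in> cycle_space G" "set vs \<subseteq> verts G"
    "\<forall>e. e \<notin> edge_of ` set es \<longrightarrow> x e = 0" "e \<notin> edge_of ` set (prune vs es)"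
  shows "x e = 0"
  using assms(3-5)
proof (induction vs es rule: prune.induct)
  case (2 v vs es)
  let ?es = "if length (filter (touches v) es) \<le> 1 then filter (\<lambda>d. \<not> touches v d) es else es"
  have "x f = 0" if f: "f \<notin> edge_of ` set ?es" for f
  proof (cases "f \<in> edge_of ` set es")
    case True
    then obtain d where d: "d \<in> set es" "f = edge_of d" by auto
    with f have le: "length (filter (touches v) es) \<le> 1" and v: "touches v d"
      by (auto split: if_splits)
    have "ds = [d]" if "d \<in> set ds" "length ds \<le> 1" for ds
      using that by (cases ds) auto
    then have one: "filter (touches v) es = [d]"
      using d v le by simp
    have zero: "x g = 0" if "v \<in> g" "g \<noteq> f" for g
    proof -
      have "g \<notin> edge_of ` set es"
      proof
        assume "g \<in> edge_of ` set es"
        then obtain d' where d': "d' \<in> set es" "g = edge_of d'" by auto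
        then have "d' \<in> set (filter (touches v) es)"
          using that by (simp add: touches_iff)
        then show False
          using that d d' one by simp
      qed
      then show ?thesis using "2.prems"(2) by blast
    qed
    show ?thesis
    proof (cases "f \<in> edges G")
      case True
      \<comment> \<open>All other edges at \<open>v\<close> carry 0, so the parity condition at
        \<open>v\<close> reads \<open>x f = 0\<close>.\<close>
      have "(\<Sum>e | e \<in> edges G \<and> v \<in> e. x e) = (\<Sum>e\<in>{f}. x e)"
        using assms(1) True zero v d by (intro sum.mono_neutral_right) (auto simp: touches_iff)
      then show ?thesis
        using assms(2) "2.prems"(1) by (simp add: cycle_space_def)
    next
      case False
      then show ?thesis using assms(2) by (simp add: cycle_space_def)
    qed
  qed (use "2.prems"(2) in blast)
  then show ?case
    using "2.IH" "2.prems" by (auto split: if_splits)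
qed auto

section \<open>Linear algebra of edge vectors\<close>

lemma subspace_cycle_space: "edge_space.subspace (cycle_space G)"
proof -
  have "x + y \<in> cycle_space G" if "x \<in> cycle_space G" "y \<in> cycle_space G" for x y
    using that by (simp only: cycle_space_def mem_Collect_eq plus_fun_def sum.distrib) simp
  moreover have "edge_scale c x \<in> cycle_space G" if "x \<in> cycle_space G" for c x
    using that by (simp only: cycle_space_def mem_Collect_eq edge_scale_def flip: sum_distrib_left) simp
  ultimately show ?thesis
    unfolding edge_space.subspace_def by (simp add: cycle_space_def)
qed

lemma edge_vector_inj: "inj edge_vector"
  by (auto simp: inj_def edge_vector_def fun_eq_iff split: if_splits)

lemma edge_vector_Un:
  "A \<inter> B = {} \<Longrightarrow> edge_vector (A \<union> B) = edge_vector A + edge_vector B"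
  by (auto simp: edge_vector_def fun_eq_iff)

text \<open>Vanishing at \<open>e\<close> defines a subspace. Evaluating at a suitable edge thus
  shows that a vector lies outside a span.\<close>

lemma span_vanish:
  assumes "x \<in> edge_space.span S" "\<And>y. y \<in> S \<Longrightarrow> y e = 0"
  shows "x e = 0"
proof -
  have "edge_space.span S \<subseteq> {y. y e = 0}"
    using assms(2) by (intro edge_space.span_minimal)
      (auto simp: edge_space.subspace_def edge_scale_def)
  then show ?thesis using assms(1) by auto
qed

section \<open>The three short cycles and the coordinates they give\<close>

definition cycle_A :: "(nat \<times> nat) list" where
  "cycle_A = [(0,1), (0,2), (1,12), (2,12)]"

definition cycle_B :: "(nat \<times> nat) list" where
  "cycle_B = [(11,14), (11,15), (14,26), (15,27), (26,27)]"

definition cycle_C :: "(nat \<times> nat) list" where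
  "cycle_C = [(17,29), (17,30), (29,37), (30,39), (37,39)]"

abbreviation "edge_set ds \<equiv> edge_of ` set ds"

text \<open>Over the two-element field the sum at \<open>v\<close> is the parity of the number of
  chosen edges at \<open>v\<close>, which can be evaluated on pairs oriented as in
  \<open>edge_list\<close>.\<close>

lemma edge_vector_cycle_space_G48:
  assumes "set ds \<subseteq> set edge_list" "distinct ds"
    "\<forall>v\<in>set [0..<48]. even (length (filter (touches v) ds))"
  shows "edge_vector (edge_set ds) \<in> cycle_space G48"
proof -
  have sub: "edge_set ds \<subseteq> edges G48"
    using assms(1) by (auto simp: edges_G48)
  have dist: "distinct (map edge_of ds)"
    using assms(1,2) distinct_edge_list by (auto simp: distinct_map intro: inj_on_subset)
  have "(\<Sum>e | e \<in> edges G48 \<and> v \<in> e. edge_vector (edge_set ds) e) = 0" if v: "v \<in> verts G48" for v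
  proof -
    have "(\<Sum>e | e \<in> edges G48 \<and> v \<in> e. edge_vector (edge_set ds) e) =
        (\<Sum>e \<in> set (map edge_of (filter (touches v) ds)). 1)"
      using sub by (intro sum.mono_neutral_cong_right) (auto simp: edges_G48 edge_vector_def touches_iff)
    also have "\<dots> = of_nat (length (filter (touches v) ds))"
      using distinct_card[OF distinct_map_filter[OF dist]] by (simp del: set_map)
    also have "\<dots> = 0"
    proof -
      have "even (length (filter (touches v) ds))"
        using assms(3) v by (simp add: G48_def)
      then obtain k where "length (filter (touches v) ds) = 2 * k" by (rule evenE)
      then show ?thesis by simp
    qed
    finally show ?thesis .
  qed
  then show ?thesis
    using sub by (auto simp: cycle_space_def edge_vector_def)
qed

lemma short_cycles_in_cycle_space:
  "edge_vector (edge_set cycle_A) \<in> cycle_space G48"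
  "edge_vector (edge_set cycle_B) \<in> cycle_space G48"
  "edge_vector (edge_set cycle_C) \<in> cycle_space G48"
  by (intro edge_vector_cycle_space_G48; code_simp)+

lemma short_cycles_is_cycle:
  "is_cycle G48 (edge_set cycle_A)"
  "is_cycle G48 (edge_set cycle_B)"
  "is_cycle G48 (edge_set cycle_C)"
proof -
  \<comment> \<open>As the image of an explicit list, the walk can be enumerated by
    simplification.\<close>
  have walk: "closed_walk_edges vs = set (map (\<lambda>i. {vs ! i, vs ! (Suc i mod length vs)}) [0..<length vs])"
    for vs :: "nat list"
    by (auto simp: closed_walk_edges_def)
  have "edge_set cycle_A = closed_walk_edges [0, 1, 12, 2]"
    "edge_set cycle_B = closed_walk_edges [11, 14, 26, 27, 15]"
    "edge_set cycle_C = closed_walk_edges [17, 29, 37, 39, 30]"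
    unfolding walk cycle_A_def cycle_B_def cycle_C_def edge_of_def
    by (simp_all add: upt_rec insert_commute)
  moreover have "edge_set cycle_A \<subseteq> edges G48" "edge_set cycle_B \<subseteq> edges G48" "edge_set cycle_C \<subseteq> edges G48"
    by (auto simp: cycle_A_def cycle_B_def cycle_C_def edges_G48 edge_list_def)
  ultimately show "is_cycle G48 (edge_set cycle_A)" "is_cycle G48 (edge_set cycle_B)"
      "is_cycle G48 (edge_set cycle_C)"
    by (auto simp: is_cycle_def intro: exI[of _ "[0, 1, 12, 2]"] exI[of _ "[11, 14, 26, 27, 15]"]
        exI[of _ "[17, 29, 37, 39, 30]"])
qed

lemma short_cycles_disjoint:
  "edge_set cycle_A \<inter> edge_set cycle_B = {}"
  "edge_set cycle_A \<inter> edge_set cycle_C = {}"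
  "edge_set cycle_B \<inter> edge_set cycle_C = {}"
  by (auto simp: cycle_A_def cycle_B_def cycle_C_def edge_of_def doubleton_eq_iff)

lemma card_short_cycles:
  "card (edge_set cycle_A) = 4" "card (edge_set cycle_B) = 5" "card (edge_set cycle_C) = 5"
  by (simp_all add: cycle_A_def cycle_B_def cycle_C_def edge_of_def doubleton_eq_iff)

text \<open>Each of these edges lies on just one of the three cycles, so the value of a vector there
  serves as the coefficient of that cycle.\<close>

lemma short_cycle_chords:
  "{0, 1} \<in> edge_set cycle_A" "{11, 14} \<in> edge_set cycle_B" "{17, 29} \<in> edge_set cycle_C"
  by (simp_all add: cycle_A_def cycle_B_def cycle_C_def edge_of_def)

text \<open>Deleting one edge from each of the three cycles leaves a tree, and pruning the leaves of a tree
  shows that no nonzero cycle vector is supported on it.\<close>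

lemma cycle_space_G48_coordinates:
  assumes x: "x \<in> cycle_space G48"
  shows "x = edge_scale (x {0, 1}) (edge_vector (edge_set cycle_A)) +
    edge_scale (x {11, 14}) (edge_vector (edge_set cycle_B)) +
    edge_scale (x {17, 29}) (edge_vector (edge_set cycle_C))" (is "x = ?y")
proof -
  define tree where "tree = filter (\<lambda>d. d \<notin> {(0,1), (11,14), (17,29)}) edge_list"
  have "x - ?y \<in> cycle_space G48"
    using x short_cycles_in_cycle_space subspace_cycle_space[of G48]
    by (intro edge_space.subspace_diff edge_space.subspace_add edge_space.subspace_scale)
  moreover have "finite (edges G48)" by (simp add: edges_G48)
  moreover have "set (concat (replicate 8 [0..<48])) \<subseteq> verts G48" by (auto simp: G48_def)
  \<comment> \<open>Off the tree, the difference vanishes at the three chords by the choice of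
    coefficients and at non-edges by membership in the cycle space.\<close>
  moreover have "(x - ?y) e = 0" if e: "e \<notin> edge_set tree" for e
  proof (cases "e \<in> edges G48")
    case True
    then have "e \<in> {{0, 1}, {11, 14}, {17, 29}}"
      using e by (auto simp: edges_G48 tree_def edge_of_def)
    moreover have "{0, 1} \<notin> edge_set cycle_B" "{0, 1} \<notin> edge_set cycle_C"
        "{11, 14} \<notin> edge_set cycle_A" "{11, 14} \<notin> edge_set cycle_C"
        "{17, 29} \<notin> edge_set cycle_A" "{17, 29} \<notin> edge_set cycle_B"
      by (simp_all add: cycle_A_def cycle_B_def cycle_C_def edge_of_def doubleton_eq_iff)
    ultimately show ?thesis
      using short_cycle_chords by (auto simp: edge_scale_def edge_vector_def)
  next
    case False
    then show ?thesis
      using calculation(1) by (simp add: cycle_space_def)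
  qed
  \<comment> \<open>Eight rounds over all vertices strip the tree completely.\<close>
  moreover have "prune (concat (replicate 8 [0..<48])) tree = []"
    unfolding tree_def by code_simp
  ultimately have zero: "(x - ?y) e = 0" for e
    using prune_cycle_space[of G48 "x - ?y" "concat (replicate 8 [0..<48])" tree e] by simp
  have "x - ?y = 0"
    unfolding zero_fun_def by (rule ext) (rule zero)
  then show ?thesis
    by (simp only: right_minus_eq)
qed

section \<open>Cycle bases of minimum total length\<close>

definition short_cycles :: "nat set set set" where
  "short_cycles = {edge_set cycle_A, edge_set cycle_B, edge_set cycle_C}"

lemma short_cycles_distinct:
  "edge_set cycle_A \<noteq> edge_set cycle_B" "edge_set cycle_A \<noteq> edge_set cycle_C"
  "edge_set cycle_B \<noteq> edge_set cycle_C"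
  using short_cycles_disjoint short_cycle_chords by (metis Int_absorb empty_iff)+

lemma card_short_cycles_set: "card short_cycles = 3"
  unfolding short_cycles_def using short_cycles_distinct by simp

text \<open>Evaluation at the three chords separates each cycle from the later ones, which gives
  independence; spanning is \<open>cycle_space_G48_coordinates\<close>.\<close>

lemma short_cycles_cycle_basis: "cycle_basis G48 short_cycles"
proof -
  let ?a = "edge_vector (edge_set cycle_A)" and ?b = "edge_vector (edge_set cycle_B)"
    and ?c = "edge_vector (edge_set cycle_C)"
  have img: "edge_vector ` short_cycles = {?a, ?b, ?c}"
    by (simp add: short_cycles_def)
  have val: "?a {0, 1} = 1" "?b {0, 1} = 0" "?c {0, 1} = 0" "?b {11, 14} = 1" "?c {11, 14} = 0"
      "?c {17, 29} = 1"
    by (simp_all add: edge_vector_def cycle_A_def cycle_B_def cycle_C_def edge_of_def doubleton_eq_iff)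
  have "?a \<notin> edge_space.span {?b, ?c}"
    using span_vanish[of ?a "{?b, ?c}" "{0, 1}"] val by auto
  moreover have "?b \<notin> edge_space.span {?c}"
    using span_vanish[of ?b "{?c}" "{11, 14}"] val by auto
  moreover have "?c \<notin> edge_space.span {}"
    using span_vanish[of ?c "{}" "{17, 29}"] val by auto
  ultimately have "edge_space.independent {?a, ?b, ?c}"
    using edge_space.independent_empty by (intro edge_space.independent_insertI)
  moreover have "edge_space.span {?a, ?b, ?c} = cycle_space G48"
  proof
    show "edge_space.span {?a, ?b, ?c} \<subseteq> cycle_space G48"
      using short_cycles_in_cycle_space subspace_cycle_space
      by (intro edge_space.span_minimal) auto
    show "cycle_space G48 \<subseteq> edge_space.span {?a, ?b, ?c}"
    proof
      fix x assume "x \<in> cycle_space G48"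
      from cycle_space_G48_coordinates[OF this] show "x \<in> edge_space.span {?a, ?b, ?c}"
        by (rule ssubst) (intro edge_space.span_add edge_space.span_scale edge_space.span_base; simp)
    qed
  qed
  ultimately show ?thesis
    unfolding cycle_basis_def img using short_cycles_is_cycle by (auto simp: short_cycles_def)
qed

lemma dim_cycle_space_G48: "edge_space.dim (cycle_space G48) = 3"
proof -
  have "edge_space.dim (cycle_space G48) = card (edge_vector ` short_cycles)"
    using short_cycles_cycle_basis unfolding cycle_basis_def
    by (metis edge_space.dim_eq_card edge_space.span_span)
  then show ?thesis
    using card_short_cycles_set by (simp add: card_image inj_on_subset[OF edge_vector_inj])
qed

text \<open>The coefficients are 0 or 1 and the cycles are disjoint, so \<open>D\<close> is a
  disjoint union of some of them. One cycle is a member of \<open>short_cycles\<close>; two or more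
  have at least 4 + 5 edges.\<close>

lemma edge_vector_in_cycle_space_G48:
  assumes "edge_vector D \<in> cycle_space G48" "D \<noteq> {}"
  shows "D \<in> short_cycles \<or> 9 \<le> card D"
proof -
  let ?A = "edge_set cycle_A" and ?B = "edge_set cycle_B" and ?C = "edge_set cycle_C"
  define x where "x = edge_vector D"
  define X where "X = (if x {0, 1} = 1 then ?A else {})"
  define Y where "Y = (if x {11, 14} = 1 then ?B else {})"
  define Z where "Z = (if x {17, 29} = 1 then ?C else {})"
  have scale: "edge_scale t (edge_vector S) = edge_vector (if t = 1 then S else {})"
    for t and S :: "nat set set"
    by (cases "t = 1") (auto simp: edge_scale_def edge_vector_def)
  have disj: "X \<inter> Y = {}" "(X \<union> Y) \<inter> Z = {}"
    unfolding X_def Y_def Z_def Int_Un_distrib2 using short_cycles_disjoint by simp_all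
  have "edge_vector D = edge_vector X + edge_vector Y + edge_vector Z"
    using cycle_space_G48_coordinates[OF assms(1)] unfolding scale X_def Y_def Z_def x_def .
  then have "edge_vector D = edge_vector (X \<union> Y \<union> Z)"
    using disj by (simp only: edge_vector_Un)
  then have D: "D = X \<union> Y \<union> Z"
    by (rule injD[OF edge_vector_inj])
  have "card D = card X + card Y + card Z"
    unfolding D using disj by (subst card_Un_disjoint; (simp add: X_def Y_def Z_def card_Un_disjoint)?)
  then show ?thesis
    using D assms(2) card_short_cycles unfolding short_cycles_def X_def Y_def Z_def
    by (auto split: if_splits)
qed

text \<open>Every basis has three members. One outside \<open>short_cycles\<close> has at least 9
  edges and the other two at least 4 each, whence 17.\<close>

lemma cycle_basis_G48_cases:
  assumes "cycle_basis G48 B"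
  shows "B = short_cycles \<or> 17 \<le> (\<Sum>D\<in>B. card D)"
proof -
  have ind: "edge_space.independent (edge_vector ` B)"
    and span: "edge_space.span (edge_vector ` B) = cycle_space G48"
    using assms by (auto simp: cycle_basis_def)
  have "card (edge_vector ` B) = 3"
    using edge_space.dim_eq_card[of "edge_vector ` B" "cycle_space G48"] ind span dim_cycle_space_G48
    by (metis edge_space.span_span)
  then have card: "card B = 3"
    by (simp add: card_image inj_on_subset[OF edge_vector_inj])
  have fin: "finite B" using card by (simp add: card_ge_0_finite)
  have cases: "D \<in> short_cycles \<or> 9 \<le> card D" if "D \<in> B" for D
  proof (rule edge_vector_in_cycle_space_G48)
    show "edge_vector D \<in> cycle_space G48"
      using that span edge_space.span_base by blast
    \<comment> \<open>An independent set does not contain the zero vector, so the empty edge set is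
      excluded.\<close>
    have "edge_vector D \<noteq> 0"
      using that ind edge_space.dependent_zero by (metis image_eqI)
    then show "D \<noteq> {}" by (auto simp: edge_vector_def fun_eq_iff)
  qed
  show ?thesis
  proof (cases "B \<subseteq> short_cycles")
    case True
    then show ?thesis
      using card card_short_cycles_set by (metis card_subset_eq card_ge_0_finite zero_less_numeral)
  next
    case False
    then obtain H where H: "H \<in> B" "9 \<le> card H" using cases by blast
    have "4 \<le> card D" if "D \<in> B" for D
      using cases[OF that] card_short_cycles by (auto simp: short_cycles_def)
    then have "4 * card (B - {H}) \<le> (\<Sum>D\<in>B - {H}. card D)"
      using sum_bounded_below[of "B - {H}" 4 card] by simp
    moreover have "card (B - {H}) = 2" using card H fin by simp
    moreover have "(\<Sum>D\<in>B. card D) = card H + (\<Sum>D\<in>B - {H}. card D)"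
      using fin H by (simp add: sum.remove)
    ultimately show ?thesis using H by simp
  qed
qed

lemma sum_card_short_cycles: "(\<Sum>D\<in>short_cycles. card D) = 14"
  unfolding short_cycles_def using short_cycles_distinct card_short_cycles by simp

text \<open>As 14 < 17, the minimum basis exists and is unique, which settles the lengths for every
  minimum basis at once.\<close>

lemma minimum_cycle_basis_G48_iff: "minimum_cycle_basis G48 B \<longleftrightarrow> B = short_cycles"
proof
  assume B: "minimum_cycle_basis G48 B"
  then have "(\<Sum>D\<in>B. card D) \<le> 14"
    using short_cycles_cycle_basis sum_card_short_cycles unfolding minimum_cycle_basis_def by metis
  then show "B = short_cycles"
    using B cycle_basis_G48_cases[of B] unfolding minimum_cycle_basis_def by auto
next
  assume "B = short_cycles"
  then show "minimum_cycle_basis G48 B"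
    using short_cycles_cycle_basis sum_card_short_cycles
    by (auto simp: minimum_cycle_basis_def dest!: cycle_basis_G48_cases)
qed

lemma cycle_lengths_short_cycles: "cycle_lengths short_cycles = {#4, 5, 5#}"
  unfolding short_cycles_def cycle_lengths_def
  using short_cycles_distinct card_short_cycles by simp

lemma card_verts_line_graph_G48: "card (verts (line_graph G48)) = 50"
  using card_edges_G48 by (simp add: line_graph_def)

theorem mainTheorem5:
  shows "connected_graph G48
    \<and> triangle_free G48
    \<and> max_degree G48 = 4
    \<and> cycle_rank G48 = 3
    \<and> edge_space.dim (cycle_space G48) = 3
    \<and> (\<exists>B. minimum_cycle_basis G48 B)
    \<and> (\<forall>B. minimum_cycle_basis G48 B \<longrightarrow> cycle_lengths B = {#4, 5, 5#})
    \<and> card (verts (line_graph G48)) = 50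
    \<and> inertia (line_graph G48) = (26, 0, 24)
    \<and> signature (line_graph G48) = 2"
proof (intro conjI)
  show "signature (line_graph G48) = 2"
    using inertia_line_graph_G48 by (simp add: signature_def inertia_def)
qed (simp_all add: connected_G48 triangle_free_G48 max_degree_G48 cycle_rank_G48 dim_cycle_space_G48
    minimum_cycle_basis_G48_iff cycle_lengths_short_cycles card_verts_line_graph_G48
    inertia_line_graph_G48)

end
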